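(* The central scheme for the scalar network with its coupling data (as defined in the context) is conservative in the coupling node, i.e. $$\sum_{k\in\delta^-}F^{k,n}_{-1/2}=\sum_{k\in\delta^+}F^{k,n}_{-1/2}\qquad\text{for all }n\in\mathbb{N}_0.$$ It is further conservative on the full network in the case $f_1(0)=f_2(0)=\dots=f_N(0)=0$, and it is conservative on bounded networks, where all edges that connect to the node are bounded and zero-flux boundary conditions are imposed.
   Context: **Network.** Let $N^-,N^+\ge1$ and $N=N^-+N^+$. The incoming edges $\delta^-=\{1,\dots,N^-\}$ are parameterized by $(-\infty,0)$ and the outgoing edges $\delta^+=\{N^-+1,\dots,N\}$ by $(0,\infty)$; $\delta^\mp=\delta^-\cup\delta^+$, and the node is at $x=0$. Put $\nu_k=-1$ for $k\in\delta^-$ and $\nu_k=1$ for $k\in\delta^+$. The problem approximated is $\partial_tu^k+\partial_xf_k(u^k)=0$ on edge $k$ with smooth $f_k:\mathbb{R}\to\mathbb{R}$. Let $\lambda_k>0$ ($k\in\delta^\mp$) be relaxation speeds and $\Delta x,\Delta t>0$. **Coupling data (Riemann solver).** Given traces $(u_0^k,v_0^k)_{k\in\delta^\mp}$ and real parameters $\beta_k^\ell,r^\ell$ ($k\in\delta^\mp$, $\ell=1,\dots,N-2$; they may depend on the traces), let $\sigma=(\sigma_1,\dots,\sigma_N)$ be the solution of the $N\times N$ linear system $$\sum_{k\in\delta^\mp}\nu_k\lambda_k\sigma_k=-\sum_{k\in\delta^\mp}\nu_kv_0^k,\qquad \sum_{k\in\delta^\mp}\lambda_k^2\sigma_k=-\sum_{k\in\delta^\mp}\nu_k\lambda_k^2u_0^k,$$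 $$\sum_{k\in\delta^\mp}\beta_k^\ell\lambda_k\sigma_k=r^\ell-\sum_{k\in\delta^\mp}\beta_k^\ell v_0^k\quad(\ell=1,\dots,N-2).$$ The parameters are assumed to be chosen such that this system has full rank. The coupling data are $$(u_R^k,v_R^k)=(u_0^k-\sigma_k,\;v_0^k+\lambda_k\sigma_k)\ \text{ for }k\in\delta^-,\qquad (u_L^k,v_L^k)=(u_0^k+\sigma_k,\;v_0^k+\lambda_k\sigma_k)\ \text{ for }k\in\delta^+.$$ (The first two equations express the Kirchhoff conditions $\sum_{k\in\delta^-}v_R^k=\sum_{k\in\delta^+}v_L^k$ and $\sum_{k\in\delta^-}\lambda_k^2u_R^k=\sum_{k\in\delta^+}\lambda_k^2u_L^k$.) **Central scheme.** Let $\mathcal{I}_k=\{j\in\mathbb{Z}:j\le-1\}$ for $k\in\delta^-$ and $\mathcal{I}_k=\{j\in\mathbb{Z}:j\ge0\}$ for $k\in\delta^+$. For $k\in\delta^\mp$, $j\in\mathcal{I}_k$, $n\in\mathbb{N}_0$, $$u_j^{k,n+1}=u_j^{k,n}-\frac{\Delta t}{\Delta x}\left(F_{j+1/2}^{k,n}-F_{j-1/2}^{k,n}\right),$$ with numerical fluxes $$F_{j-1/2}^{k,n}=\begin{cases}\frac12\left(f_k(u_j^{k,n})+f_k(u_{j-1}^{k,n})\right)-\frac{\lambda_k}2\left(u_j^{k,n}-u_{j-1}^{k,n}\right)-\mathcal{S}_{j-1/2}^{k,n}&\text{if }j\,\nu_k>0,\\[4pt]\frac12\left(v_R^{k,n}+f_k(u_{-1}^{k,n})\right)-\frac{\lambda_k}2\left(u_R^{k,n}-u_{-1}^{k,n}\right)&\text{if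 }j=0,\ k\in\delta^-,\\[4pt]\frac12\left(f_k(u_0^{k,n})+v_L^{k,n}\right)-\frac{\lambda_k}2\left(u_0^{k,n}-u_L^{k,n}\right)&\text{if }j=0,\ k\in\delta^+.\end{cases}$$ The coupling data at time step $n$ are given by the Riemann solver above applied to the traces $u_0^k:=u_{-1}^{k,n}$, $v_0^k:=f_k(u_{-1}^{k,n})$ for $k\in\delta^-$ and $u_0^k:=u_0^{k,n}$, $v_0^k:=f_k(u_0^{k,n})$ for $k\in\delta^+$ (on the right-hand sides, the subscript is the cell index). **Extension terms.** Either $\mathcal{S}_{j-1/2}^{k,n}=0$ for all $j,k,n$ (first order scheme), or (second order scheme) $\mathcal{S}_{j-1/2}^{k,n}=\frac{\Delta x}2\left(s_j^{k,n-}-s_{j-1}^{k,n+}\right)$ with $$s_j^{k,n\mp}=\operatorname{minmod}\left(2\frac{w_j^{k,n\mp}-w_{j-1}^{k,n\mp}}{\Delta x},\ \frac{w_{j+1}^{k,n\mp}-w_{j-1}^{k,n\mp}}{2\Delta x},\ 2\frac{w_{j+1}^{k,n\mp}-w_j^{k,n\mp}}{\Delta x}\right),\qquad w_j^{k,n\mp}=\tfrac12f_k(u_j^{k,n})\mp\tfrac{\lambda_k}2u_j^{k,n}.$$ In the slopes of the cells next to the node, the missing neighbour values beyond the node are the ghost values $\tfrac12v_R^{k,n}\mp\tfrac{\lambda_k}2u_R^{k,n}$ (in place of $w_0^{k,n\mp}$, $k\in\delta^-$) and $\tfrac12v_L^{k,n}\mp\tfrac{\lambda_k}2u_L^{k,n}$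 (in place of $w_{-1}^{k,n\mp}$, $k\in\delta^+$). Here $\operatorname{minmod}(q_1,\dots,q_m)$ equals $\max_iq_i$ if all $q_i<0$, $\min_iq_i$ if all $q_i>0$, and $0$ otherwise. **Notions of conservation.** On the unbounded network the initial data are compactly supported, i.e. $u_j^{k,0}=0$ for all but finitely many $(k,j)$. - *Conservative on the full network*: $\sum_{k\in\delta^\mp}\sum_{j\in\mathcal{I}_k}u_j^{k,n}$ is independent of $n$. - *Conservative on bounded networks with zero-flux boundary conditions*: if each edge $k$ has only finitely many cells, namely $-M_k\le j\le-1$ for $k\in\delta^-$ and $0\le j\le M_k-1$ for $k\in\delta^+$, and the numerical flux of edge $k$ at its end away from the node is replaced by $0$, then the total mass (the sum of $u_j^{k,n}$ over all cells of all edges) is independent of $n$. *)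

theory Defs
  imports "HOL-Analysis.Analysis" "Jordan_Normal_Form.DL_Rank"
begin

definition smooth :: "(real \<Rightarrow> real) \<Rightarrow> bool" where
  "smooth g \<longleftrightarrow> (\<forall>m. (deriv ^^ m) g differentiable_on UNIV)"

text \<open>
  Edges are numbered from 1, incoming ones first. The coupling parameters may depend on the
  traces: \<open>beta S u\<^sub>0 v\<^sub>0 l k\<close> and \<open>rpar S u\<^sub>0 v\<^sub>0 l\<close> are the parameters for the traces
  \<open>(u\<^sub>0 k, v\<^sub>0 k)\<close>, with \<open>l\<close> ranging over \<open>1, \<dots>, N - 2\<close>.
\<close>

record network_scheme =
  n_in :: nat
  n_out :: nat
  flux_fn :: "nat \<Rightarrow> real \<Rightarrow> real"
  speed :: "nat \<Rightarrow> real"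
  cell_width :: real
  time_step :: real
  beta :: "(nat \<Rightarrow> real) \<Rightarrow> (nat \<Rightarrow> real) \<Rightarrow> nat \<Rightarrow> nat \<Rightarrow> real"
  rpar :: "(nat \<Rightarrow> real) \<Rightarrow> (nat \<Rightarrow> real) \<Rightarrow> nat \<Rightarrow> real"

definition n_edges :: "network_scheme \<Rightarrow> nat" where
  "n_edges S = n_in S + n_out S"

definition in_edges :: "network_scheme \<Rightarrow> nat set" where
  "in_edges S = {1..n_in S}"

definition out_edges :: "network_scheme \<Rightarrow> nat set" where
  "out_edges S = {n_in S + 1..n_edges S}"

definition edges :: "network_scheme \<Rightarrow> nat set" where
  "edges S = in_edges S \<union> out_edges S"

definition nu :: "network_scheme \<Rightarrow> nat \<Rightarrow> real" where
  "nu S k = (if k \<in> in_edges S then -1 else 1)"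

definition cells :: "network_scheme \<Rightarrow> nat \<Rightarrow> int set" where
  "cells S k = (if k \<in> in_edges S then {..-1} else {0..})"

definition coupling_system ::
  "network_scheme \<Rightarrow> (nat \<Rightarrow> real) \<Rightarrow> (nat \<Rightarrow> real) \<Rightarrow> (nat \<Rightarrow> real) \<Rightarrow> bool" where
  "coupling_system S u0 v0 \<sigma> \<longleftrightarrow>
     (\<Sum>k\<in>edges S. nu S k * speed S k * \<sigma> k) = - (\<Sum>k\<in>edges S. nu S k * v0 k) \<and>
     (\<Sum>k\<in>edges S. (speed S k)\<^sup>2 * \<sigma> k) = - (\<Sum>k\<in>edges S. nu S k * (speed S k)\<^sup>2 * u0 k) \<and>
     (\<forall>l\<in>{1..n_edges S - 2}.
        (\<Sum>k\<in>edges S. beta S u0 v0 l k * speed S k * \<sigma> k)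
          = rpar S u0 v0 l - (\<Sum>k\<in>edges S. beta S u0 v0 l k * v0 k))"

text \<open>
  Matrix indices start at 0: column \<open>c\<close> belongs to edge \<open>c + 1\<close>, and row \<open>i \<ge> 2\<close> to the equation
  of \<open>coupling_system\<close> with \<open>l = i - 1\<close>.
\<close>

definition coupling_matrix ::
  "network_scheme \<Rightarrow> (nat \<Rightarrow> real) \<Rightarrow> (nat \<Rightarrow> real) \<Rightarrow> real Matrix.mat" where
  "coupling_matrix S u0 v0 = Matrix.mat (n_edges S) (n_edges S) (\<lambda>(i, c).
     if i = 0 then nu S (c + 1) * speed S (c + 1)
     else if i = 1 then (speed S (c + 1))\<^sup>2
     else beta S u0 v0 (i - 1) (c + 1) * speed S (c + 1))"

definition full_rank_coupling :: "network_scheme \<Rightarrow> bool" where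
  "full_rank_coupling S \<longleftrightarrow>
     (\<forall>u0 v0. vec_space.rank (n_edges S) (coupling_matrix S u0 v0) = n_edges S)"

definition scheme_data :: "network_scheme \<Rightarrow> bool" where
  "scheme_data S \<longleftrightarrow>
     n_in S \<ge> 1 \<and> n_out S \<ge> 1 \<and>
     (\<forall>k\<in>edges S. smooth (flux_fn S k) \<and> speed S k > 0) \<and>
     cell_width S > 0 \<and> time_step S > 0 \<and>
     full_rank_coupling S"

text \<open>The values off the edges are fixed only to make the solution unique as a function on \<open>nat\<close>.\<close>

definition jump ::
  "network_scheme \<Rightarrow> (nat \<Rightarrow> real) \<Rightarrow> (nat \<Rightarrow> real) \<Rightarrow> nat \<Rightarrow> real" where
  "jump S u0 v0 = (THE \<sigma>. coupling_system S u0 v0 \<sigma> \<and> (\<forall>k. k \<notin> edges S \<longrightarrow> \<sigma> k = 0))"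

text \<open>
  Below, \<open>w k j\<close> is the value in cell \<open>j\<close> of edge \<open>k\<close> at one fixed time. The coupling values
  stand for \<open>(u\<^sub>R, v\<^sub>R)\<close> on incoming and for \<open>(u\<^sub>L, v\<^sub>L)\<close> on outgoing edges.
\<close>

definition trace_u :: "network_scheme \<Rightarrow> (nat \<Rightarrow> int \<Rightarrow> real) \<Rightarrow> nat \<Rightarrow> real" where
  "trace_u S w k = (if k \<in> in_edges S then w k (-1) else w k 0)"

definition trace_v :: "network_scheme \<Rightarrow> (nat \<Rightarrow> int \<Rightarrow> real) \<Rightarrow> nat \<Rightarrow> real" where
  "trace_v S w k = flux_fn S k (trace_u S w k)"

definition coupling_u :: "network_scheme \<Rightarrow> (nat \<Rightarrow> int \<Rightarrow> real) \<Rightarrow> nat \<Rightarrow> real" where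
  "coupling_u S w k =
     (let \<sigma> = jump S (trace_u S w) (trace_v S w)
      in if k \<in> in_edges S then trace_u S w k - \<sigma> k else trace_u S w k + \<sigma> k)"

definition coupling_v :: "network_scheme \<Rightarrow> (nat \<Rightarrow> int \<Rightarrow> real) \<Rightarrow> nat \<Rightarrow> real" where
  "coupling_v S w k =
     (let \<sigma> = jump S (trace_u S w) (trace_v S w) in trace_v S w k + speed S k * \<sigma> k)"

definition minmod :: "real list \<Rightarrow> real" where
  "minmod qs =
     (if \<forall>q\<in>set qs. q < 0 then Max (set qs)
      else if \<forall>q\<in>set qs. q > 0 then Min (set qs)
      else 0)"

text \<open>
  The superscripts minus and plus of the split states and of the slopes are encoded by the
  argument \<open>s = -1\<close> and \<open>s = 1\<close>. The first value beyond the node is the ghost value built from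
  the coupling data; values further beyond the node never enter the scheme.
\<close>

definition split_state ::
  "network_scheme \<Rightarrow> (nat \<Rightarrow> int \<Rightarrow> real) \<Rightarrow> nat \<Rightarrow> real \<Rightarrow> int \<Rightarrow> real" where
  "split_state S w k s j =
     (if k \<in> in_edges S \<and> j = 0 \<or> k \<in> out_edges S \<and> j = -1
      then coupling_v S w k / 2 + s * (speed S k / 2 * coupling_u S w k)
      else flux_fn S k (w k j) / 2 + s * (speed S k / 2 * w k j))"

definition slope ::
  "network_scheme \<Rightarrow> (nat \<Rightarrow> int \<Rightarrow> real) \<Rightarrow> nat \<Rightarrow> real \<Rightarrow> int \<Rightarrow> real" where
  "slope S w k s j =
     (let W = split_state S w k s; h = cell_width S
      in minmod [2 * ((W j - W (j - 1)) / h),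
                 (W (j + 1) - W (j - 1)) / (2 * h),
                 2 * ((W (j + 1) - W j) / h)])"

datatype scheme_order = First_Order | Second_Order

text \<open>
  \<open>extension_term S ord sl k j\<close> and \<open>num_flux S ord sl w k j\<close> belong to the face \<open>j - 1/2\<close>;
  \<open>sl k s j\<close> are the slopes in use. Only faces with \<open>j * nu S k \<ge> 0\<close> occur.
\<close>

definition extension_term ::
  "network_scheme \<Rightarrow> scheme_order \<Rightarrow> (nat \<Rightarrow> real \<Rightarrow> int \<Rightarrow> real) \<Rightarrow> nat \<Rightarrow> int \<Rightarrow> real" where
  "extension_term S ord sl k j =
     (case ord of
        First_Order \<Rightarrow> 0
      | Second_Order \<Rightarrow> cell_width S / 2 * (sl k (-1) j - sl k 1 (j - 1)))"

definition num_flux ::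
  "network_scheme \<Rightarrow> scheme_order \<Rightarrow> (nat \<Rightarrow> real \<Rightarrow> int \<Rightarrow> real) \<Rightarrow>
     (nat \<Rightarrow> int \<Rightarrow> real) \<Rightarrow> nat \<Rightarrow> int \<Rightarrow> real" where
  "num_flux S ord sl w k j =
     (if real_of_int j * nu S k > 0 then
        (flux_fn S k (w k j) + flux_fn S k (w k (j - 1))) / 2
          - speed S k / 2 * (w k j - w k (j - 1)) - extension_term S ord sl k j
      else if k \<in> in_edges S then
        (coupling_v S w k + flux_fn S k (w k (-1))) / 2
          - speed S k / 2 * (coupling_u S w k - w k (-1))
      else
        (flux_fn S k (w k 0) + coupling_v S w k) / 2
          - speed S k / 2 * (w k 0 - coupling_u S w k))"

definition central_flux ::
  "network_scheme \<Rightarrow> scheme_order \<Rightarrow> (nat \<Rightarrow> int \<Rightarrow> real) \<Rightarrow> nat \<Rightarrow> int \<Rightarrow> real" where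
  "central_flux S ord w = num_flux S ord (slope S w) w"

definition central_scheme ::
  "network_scheme \<Rightarrow> scheme_order \<Rightarrow> (nat \<Rightarrow> nat \<Rightarrow> int \<Rightarrow> real) \<Rightarrow> bool" where
  "central_scheme S ord u \<longleftrightarrow>
     (\<forall>n. \<forall>k\<in>edges S. \<forall>j\<in>cells S k.
        u (Suc n) k j = u n k j - time_step S / cell_width S *
          (central_flux S ord (u n) k (j + 1) - central_flux S ord (u n) k j))"

definition conservative_in_node ::
  "network_scheme \<Rightarrow> scheme_order \<Rightarrow> (nat \<Rightarrow> nat \<Rightarrow> int \<Rightarrow> real) \<Rightarrow> bool" where
  "conservative_in_node S ord u \<longleftrightarrow>
     (\<forall>n. (\<Sum>k\<in>in_edges S. central_flux S ord (u n) k 0)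
          = (\<Sum>k\<in>out_edges S. central_flux S ord (u n) k 0))"

definition compactly_supported :: "network_scheme \<Rightarrow> (nat \<Rightarrow> int \<Rightarrow> real) \<Rightarrow> bool" where
  "compactly_supported S w \<longleftrightarrow> finite {(k, j). k \<in> edges S \<and> j \<in> cells S k \<and> w k j \<noteq> 0}"

text \<open>Summability is demanded explicitly because \<open>infsum\<close> is 0 for divergent sums.\<close>

definition conservative_full ::
  "network_scheme \<Rightarrow> (nat \<Rightarrow> nat \<Rightarrow> int \<Rightarrow> real) \<Rightarrow> bool" where
  "conservative_full S u \<longleftrightarrow>
     (\<forall>n. \<forall>k\<in>edges S. u n k summable_on cells S k) \<and>
     (\<forall>n m. (\<Sum>k\<in>edges S. \<Sum>\<^sub>\<infinity>j\<in>cells S k. u n k j)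
            = (\<Sum>k\<in>edges S. \<Sum>\<^sub>\<infinity>j\<in>cells S k. u m k j))"

text \<open>
  Bounded networks: edge \<open>k\<close> has \<open>M k\<close> cells. The slope in the cell away from the node would
  need a neighbour that does not exist; the value \<open>e k s\<close> used for it is left arbitrary, which
  covers every choice of a one-sided slope or of a ghost value there.
\<close>

definition bounded_cells :: "network_scheme \<Rightarrow> (nat \<Rightarrow> nat) \<Rightarrow> nat \<Rightarrow> int set" where
  "bounded_cells S M k = (if k \<in> in_edges S then {- int (M k)..-1} else {0..int (M k) - 1})"

definition end_cell :: "network_scheme \<Rightarrow> (nat \<Rightarrow> nat) \<Rightarrow> nat \<Rightarrow> int" where
  "end_cell S M k = (if k \<in> in_edges S then - int (M k) else int (M k) - 1)"

text \<open>As everywhere, index \<open>j\<close> refers to the face \<open>j - 1/2\<close>.\<close>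

definition end_face :: "network_scheme \<Rightarrow> (nat \<Rightarrow> nat) \<Rightarrow> nat \<Rightarrow> int" where
  "end_face S M k = (if k \<in> in_edges S then - int (M k) else int (M k))"

definition bounded_slope ::
  "network_scheme \<Rightarrow> (nat \<Rightarrow> nat) \<Rightarrow> (nat \<Rightarrow> real \<Rightarrow> real) \<Rightarrow>
     (nat \<Rightarrow> int \<Rightarrow> real) \<Rightarrow> nat \<Rightarrow> real \<Rightarrow> int \<Rightarrow> real" where
  "bounded_slope S M e w k s j = (if j = end_cell S M k then e k s else slope S w k s j)"

definition bounded_flux ::
  "network_scheme \<Rightarrow> scheme_order \<Rightarrow> (nat \<Rightarrow> nat) \<Rightarrow> (nat \<Rightarrow> real \<Rightarrow> real) \<Rightarrow>
     (nat \<Rightarrow> int \<Rightarrow> real) \<Rightarrow> nat \<Rightarrow> int \<Rightarrow> real" where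
  "bounded_flux S ord M e w k j =
     (if j = end_face S M k then 0 else num_flux S ord (bounded_slope S M e w) w k j)"

definition bounded_scheme ::
  "network_scheme \<Rightarrow> scheme_order \<Rightarrow> (nat \<Rightarrow> nat) \<Rightarrow> (nat \<Rightarrow> nat \<Rightarrow> real \<Rightarrow> real) \<Rightarrow>
     (nat \<Rightarrow> nat \<Rightarrow> int \<Rightarrow> real) \<Rightarrow> bool" where
  "bounded_scheme S ord M e u \<longleftrightarrow>
     (\<forall>n. \<forall>k\<in>edges S. \<forall>j\<in>bounded_cells S M k.
        u (Suc n) k j = u n k j - time_step S / cell_width S *
          (bounded_flux S ord M (e n) (u n) k (j + 1) - bounded_flux S ord M (e n) (u n) k j))"

definition conservative_bounded ::
  "network_scheme \<Rightarrow> (nat \<Rightarrow> nat) \<Rightarrow> (nat \<Rightarrow> nat \<Rightarrow> int \<Rightarrow> real) \<Rightarrow> bool" where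
  "conservative_bounded S M u \<longleftrightarrow>
     (\<forall>n m. (\<Sum>k\<in>edges S. \<Sum>j\<in>bounded_cells S M k. u n k j)
            = (\<Sum>k\<in>edges S. \<Sum>j\<in>bounded_cells S M k. u m k j))"

end

theory Submission
  imports Defs
begin

text \<open>
  The finite volume update is in divergence form, so on each edge the total mass changes only
  through the faces at the two ends of the edge. Conservation therefore rests on two facts.

  At the node, inserting the coupling data into the numerical flux collapses it: the jump
  \<open>\<sigma>\<^sub>k\<close> enters once through the coupling value of \<open>v\<close> and once through the
  viscosity term, each time with weight \<open>1/2\<close>, and the flux becomes
  \<open>v\<^sub>0 k + speed S k * \<sigma>\<^sub>k\<close>, which is exactly the coupling value of \<open>v\<close>. The first
  equation of the coupling system is the Kirchhoff condition for these values, so the node fluxes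
  balance (\<open>num_flux_balanced_at_node\<close>). That the jump solves the coupling system at all is where
  the full rank assumption enters (\<open>jump_solves_coupling_system\<close>).

  At the far ends the flux vanishes. On a bounded network this is imposed. On the full network it
  follows from finite speed of propagation: the stencil has finite width and a zero state has zero
  flux if \<open>flux_fn S k 0 = 0\<close>, so the support grows by a bounded number of cells in each step
  (\<open>supported_within_step\<close>). At every single step the full network thus behaves like a bounded
  one with zero-flux ends, and both claims reduce to the same telescoping argument
  (\<open>mass_balance\<close>).
\<close>

section \<open>Solvability of the coupling system\<close>

lemma ex_solution_if_det_nonzero:
  fixes A :: "'a::field Matrix.mat"
  assumes A: "A \<in> carrier_mat n n" and det: "Determinant.det A \<noteq> 0" and b: "b \<in> carrier_vec n"
  shows "\<exists>x\<in>carrier_vec n. A *\<^sub>v x = b"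
proof -
  obtain B where B: "B \<in> carrier_mat n n" "A * B = 1\<^sub>m n"
    using det_non_zero_imp_unit[OF A det, of "()"] unfolding Units_def ring_mat_def by auto
  have "A *\<^sub>v (B *\<^sub>v b) = (A * B) *\<^sub>v b"
    using assoc_mult_mat_vec[OF A B(1) b] by simp
  also have "\<dots> = b" using B b by simp
  finally show ?thesis using mult_mat_vec_carrier[OF B(1) b] by blast
qed

lemma solution_unique_if_det_nonzero:
  fixes A :: "'a::field Matrix.mat"
  assumes A: "A \<in> carrier_mat n n" and det: "Determinant.det A \<noteq> 0"
    and x: "x \<in> carrier_vec n" and y: "y \<in> carrier_vec n" and eq: "A *\<^sub>v x = A *\<^sub>v y"
  shows "x = y"
proof -
  have "A *\<^sub>v (x - y) = A *\<^sub>v x - A *\<^sub>v y"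
    using A x y by (rule mult_minus_distrib_mat_vec)
  also have "\<dots> = 0\<^sub>v n" using eq A y by simp
  finally have "x - y = 0\<^sub>v n"
    using det det_0_iff_vec_prod_zero_field[OF A] minus_carrier_vec[OF x y] by blast
  show ?thesis
  proof (rule eq_vecI)
    fix i assume "i < dim_vec y"
    then have "vec_index (x - y) i = 0" using \<open>x - y = 0\<^sub>v n\<close> y by simp
    then show "vec_index x i = vec_index y i" using \<open>i < dim_vec y\<close> x y by simp
  qed (use x y in simp)
qed

lemma edges_eq: "edges S = {1..n_edges S}"
  by (auto simp: edges_def in_edges_def out_edges_def n_edges_def)

lemma finite_edges [simp]: "finite (edges S)"
  by (simp add: edges_eq)

lemma sum_edges_shift:
  fixes g :: "nat \<Rightarrow> real"
  shows "(\<Sum>k\<in>edges S. g k) = (\<Sum>c\<in>{0..<n_edges S}. g (c + 1))"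
  unfolding edges_eq
  by (rule sum.reindex_bij_witness[where i = "\<lambda>c. c + 1" and j = "\<lambda>k. k - 1"]) auto

lemma sum_edges_split:
  fixes g :: "nat \<Rightarrow> real"
  shows "(\<Sum>k\<in>edges S. g k) = (\<Sum>k\<in>in_edges S. g k) + (\<Sum>k\<in>out_edges S. g k)"
  unfolding edges_def
  by (rule sum.union_disjoint) (auto simp: in_edges_def out_edges_def)

lemma out_edges_not_in: "k \<in> out_edges S \<Longrightarrow> k \<notin> in_edges S"
  by (auto simp: in_edges_def out_edges_def)

definition coupling_rhs ::
  "network_scheme \<Rightarrow> (nat \<Rightarrow> real) \<Rightarrow> (nat \<Rightarrow> real) \<Rightarrow> real Matrix.vec" where
  "coupling_rhs S u0 v0 = Matrix.vec (n_edges S) (\<lambda>i.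
     if i = 0 then - (\<Sum>k\<in>edges S. nu S k * v0 k)
     else if i = 1 then - (\<Sum>k\<in>edges S. nu S k * (speed S k)\<^sup>2 * u0 k)
     else rpar S u0 v0 (i - 1) - (\<Sum>k\<in>edges S. beta S u0 v0 (i - 1) k * v0 k))"

definition edge_vec :: "network_scheme \<Rightarrow> (nat \<Rightarrow> real) \<Rightarrow> real Matrix.vec" where
  "edge_vec S \<sigma> = Matrix.vec (n_edges S) (\<lambda>c. \<sigma> (c + 1))"

lemma edge_vec_carrier: "edge_vec S \<sigma> \<in> carrier_vec (n_edges S)"
  by (simp add: edge_vec_def)

lemma coupling_matrix_carrier: "coupling_matrix S u0 v0 \<in> carrier_mat (n_edges S) (n_edges S)"
  by (simp add: coupling_matrix_def)

lemma coupling_matrix_mult_edge_vec: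
  assumes "i < n_edges S"
  shows "vec_index (coupling_matrix S u0 v0 *\<^sub>v edge_vec S \<sigma>) i =
    (if i = 0 then \<Sum>k\<in>edges S. nu S k * speed S k * \<sigma> k
     else if i = 1 then \<Sum>k\<in>edges S. (speed S k)\<^sup>2 * \<sigma> k
     else \<Sum>k\<in>edges S. beta S u0 v0 (i - 1) k * speed S k * \<sigma> k)"
  using assms
  by (auto simp: coupling_matrix_def edge_vec_def scalar_prod_def sum_edges_shift
      intro!: sum.cong)

lemma coupling_system_iff:
  assumes "n_edges S \<ge> 2"
  shows "coupling_system S u0 v0 \<sigma> \<longleftrightarrow>
    coupling_matrix S u0 v0 *\<^sub>v edge_vec S \<sigma> = coupling_rhs S u0 v0"
    (is "?system \<longleftrightarrow> ?A *\<^sub>v _ = ?b")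
proof -
  let ?row = "\<lambda>i. vec_index (?A *\<^sub>v edge_vec S \<sigma>) i = vec_index ?b i"
  have "?A *\<^sub>v edge_vec S \<sigma> = ?b \<longleftrightarrow> (\<forall>i<n_edges S. ?row i)"
    by (auto simp: Matrix.vec_eq_iff coupling_matrix_def coupling_rhs_def)
  \<comment> \<open>The last \<open>N - 2\<close> rows are re-indexed by \<open>l = i - 1\<close>.\<close>
  also have "\<dots> \<longleftrightarrow> ?row 0 \<and> ?row 1 \<and> (\<forall>l\<in>{1..n_edges S - 2}. ?row (l + 1))"
  proof (intro iffI conjI allI impI)
    fix i assume rows: "?row 0 \<and> ?row 1 \<and> (\<forall>l\<in>{1..n_edges S - 2}. ?row (l + 1))"
      and i: "i < n_edges S"
    consider "i = 0" | "i = 1" | "i - 1 \<in> {1..n_edges S - 2}" "i = (i - 1) + 1"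
      using i by force
    then show "?row i" using rows by cases (metis+)
  qed (use assms in auto)
  also have "\<dots> \<longleftrightarrow> ?system"
  proof -
    have "?row (l + 1) \<longleftrightarrow> (\<Sum>k\<in>edges S. beta S u0 v0 l k * speed S k * \<sigma> k)
        = rpar S u0 v0 l - (\<Sum>k\<in>edges S. beta S u0 v0 l k * v0 k)"
      if "l \<in> {1..n_edges S - 2}" for l
    proof -
      have "l + 1 < n_edges S" "l \<noteq> 0" using that assms by auto
      then show ?thesis
        by (subst coupling_matrix_mult_edge_vec) (simp_all add: coupling_rhs_def)
    qed
    moreover have "?row 0 \<longleftrightarrow>
        (\<Sum>k\<in>edges S. nu S k * speed S k * \<sigma> k) = - (\<Sum>k\<in>edges S. nu S k * v0 k)"
      using assms by (subst coupling_matrix_mult_edge_vec) (simp_all add: coupling_rhs_def)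
    moreover have "?row 1 \<longleftrightarrow> (\<Sum>k\<in>edges S. (speed S k)\<^sup>2 * \<sigma> k)
        = - (\<Sum>k\<in>edges S. nu S k * (speed S k)\<^sup>2 * u0 k)"
      using assms by (subst coupling_matrix_mult_edge_vec) (simp_all add: coupling_rhs_def)
    ultimately show ?thesis unfolding coupling_system_def by blast
  qed
  finally show ?thesis by simp
qed

text \<open>
  The jump is a definite description, so its equations are available only because the full rank
  of the coupling matrix makes the solution exist and be unique.
\<close>

lemma jump_solves_coupling_system:
  assumes "scheme_data S"
  shows "coupling_system S u0 v0 (jump S u0 v0)"
proof -
  let ?A = "coupling_matrix S u0 v0" and ?N = "n_edges S"
  have N: "?N \<ge> 2" using assms by (auto simp: scheme_data_def n_edges_def)
  have "vec_space.rank ?N ?A = ?N"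
    using assms by (auto simp: scheme_data_def full_rank_coupling_def)
  then have det: "Determinant.det ?A \<noteq> 0"
    using vec_space.det_rank_iff[OF coupling_matrix_carrier] by blast
  obtain x where x: "x \<in> carrier_vec ?N" "?A *\<^sub>v x = coupling_rhs S u0 v0"
    using ex_solution_if_det_nonzero[OF coupling_matrix_carrier det, of "coupling_rhs S u0 v0"]
    by (auto simp: coupling_rhs_def)
  define \<sigma> where "\<sigma> k = (if k \<in> edges S then vec_index x (k - 1) else 0)" for k
  have "edge_vec S \<sigma> = x"
    using x(1) by (auto simp: edge_vec_def \<sigma>_def edges_eq)
  then have \<sigma>: "coupling_system S u0 v0 \<sigma> \<and> (\<forall>k. k \<notin> edges S \<longrightarrow> \<sigma> k = 0)"
    using x(2) by (simp add: coupling_system_iff[OF N] \<sigma>_def)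
  have unique: "\<tau> = \<sigma>"
    if "coupling_system S u0 v0 \<tau> \<and> (\<forall>k. k \<notin> edges S \<longrightarrow> \<tau> k = 0)" for \<tau>
  proof
    fix k
    have "?A *\<^sub>v edge_vec S \<tau> = ?A *\<^sub>v edge_vec S \<sigma>"
      using that \<sigma> coupling_system_iff[OF N] by metis
    then have eq: "edge_vec S \<tau> = edge_vec S \<sigma>"
      by (rule solution_unique_if_det_nonzero[OF coupling_matrix_carrier det
            edge_vec_carrier edge_vec_carrier])
    show "\<tau> k = \<sigma> k"
    proof (cases "k \<in> edges S")
      case True
      then have k: "k - 1 < ?N" "k - 1 + 1 = k" by (auto simp: edges_eq)
      then show ?thesis using arg_cong[OF eq, of "\<lambda>v. vec_index v (k - 1)"]
        by (simp add: edge_vec_def)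
    next
      case False
      then show ?thesis using that \<sigma> by simp
    qed
  qed
  from theI[of "\<lambda>\<sigma>. coupling_system S u0 v0 \<sigma> \<and> (\<forall>k. k \<notin> edges S \<longrightarrow> \<sigma> k = 0)", OF \<sigma> unique]
  show ?thesis unfolding jump_def by blast
qed

section \<open>The flux at the node\<close>

text \<open>
  Half of the contribution \<open>speed S k * \<sigma>\<^sub>k\<close> comes from averaging with the coupling value
  of \<open>v\<close>, the other half from the viscosity acting on the jump in \<open>u\<close>; the opposite signs of
  \<open>\<sigma>\<^sub>k\<close> in the coupling values of \<open>u\<close> on incoming and outgoing edges compensate the
  opposite sides on which the coupling values are placed.
\<close>

lemma num_flux_at_node: "num_flux S ord sl w k 0 = coupling_v S w k"
proof -
  define \<sigma> where "\<sigma> = jump S (trace_u S w) (trace_v S w)"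
  have v: "coupling_v S w k = trace_v S w k + speed S k * \<sigma> k"
    by (simp add: coupling_v_def \<sigma>_def)
  have u: "coupling_u S w k =
      (if k \<in> in_edges S then trace_u S w k - \<sigma> k else trace_u S w k + \<sigma> k)"
    by (simp add: coupling_u_def \<sigma>_def)
  show ?thesis
    unfolding num_flux_def v u trace_u_def trace_v_def
    by (cases "k \<in> in_edges S") (simp_all, argo+)
qed

lemma kirchhoff_coupling_v:
  assumes "scheme_data S"
  shows "(\<Sum>k\<in>in_edges S. coupling_v S w k) = (\<Sum>k\<in>out_edges S. coupling_v S w k)"
proof -
  define \<sigma> where "\<sigma> = jump S (trace_u S w) (trace_v S w)"
  have "coupling_system S (trace_u S w) (trace_v S w) \<sigma>"
    unfolding \<sigma>_def by (rule jump_solves_coupling_system[OF assms])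
  then have "(\<Sum>k\<in>edges S. nu S k * speed S k * \<sigma> k)
      = - (\<Sum>k\<in>edges S. nu S k * trace_v S w k)"
    unfolding coupling_system_def by blast
  then have "0 = (\<Sum>k\<in>edges S. nu S k * speed S k * \<sigma> k)
      + (\<Sum>k\<in>edges S. nu S k * trace_v S w k)"
    by linarith
  also have "\<dots> = (\<Sum>k\<in>edges S. nu S k * speed S k * \<sigma> k + nu S k * trace_v S w k)"
    by (rule sum.distrib[symmetric])
  also have "\<dots> = (\<Sum>k\<in>edges S. nu S k * coupling_v S w k)"
    by (simp add: coupling_v_def \<sigma>_def distrib_left mult.assoc add.commute)
  also have "\<dots> = (\<Sum>k\<in>in_edges S. - coupling_v S w k) + (\<Sum>k\<in>out_edges S. coupling_v S w k)"
    unfolding sum_edges_split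
    by (intro arg_cong2[where f = "(+)"] sum.cong) (auto simp: nu_def out_edges_not_in)
  finally show ?thesis by (simp add: sum_negf)
qed

lemma num_flux_balanced_at_node:
  assumes "scheme_data S"
  shows "(\<Sum>k\<in>in_edges S. num_flux S ord sl w k 0) = (\<Sum>k\<in>out_edges S. num_flux S ord sl w k 0)"
  unfolding num_flux_at_node by (rule kirchhoff_coupling_v[OF assms])

section \<open>Mass balance for schemes in divergence form\<close>

lemma sum_int_telescope:
  fixes G :: "int \<Rightarrow> real"
  shows "(\<Sum>j\<in>{a..<a + int m}. G (j + 1) - G j) = G (a + int m) - G a"
proof (induction m)
  case 0
  show ?case by simp
next
  case (Suc m)
  have "{a..<a + int (Suc m)} = insert (a + int m) {a..<a + int m}" by auto
  then have "(\<Sum>j\<in>{a..<a + int (Suc m)}. G (j + 1) - G j)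
      = G (a + int m + 1) - G (a + int m) + (\<Sum>j\<in>{a..<a + int m}. G (j + 1) - G j)"
    by (metis (no_types, lifting) atLeastLessThan_iff finite_atLeastLessThan_int less_irrefl
        sum.insert)
  then show ?case using Suc.IH by (simp add: add_ac)
qed

text \<open>
  An incoming edge loses its node flux and an outgoing edge gains it; these are the only
  contributions left after telescoping, because the flux at the far end of every edge is zero.
  Here \<open>w\<close> and \<open>w'\<close> are the states before and after one step.
\<close>

lemma mass_balance:
  fixes G :: "nat \<Rightarrow> int \<Rightarrow> real" and c :: real
  assumes step: "\<And>k j. k \<in> edges S \<Longrightarrow> j \<in> bounded_cells S M k \<Longrightarrow>
      w' k j = w k j - c * (G k (j + 1) - G k j)"
    and ends: "\<And>k. k \<in> edges S \<Longrightarrow> G k (end_face S M k) = 0"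
    and node: "(\<Sum>k\<in>in_edges S. G k 0) = (\<Sum>k\<in>out_edges S. G k 0)"
  shows "(\<Sum>k\<in>edges S. \<Sum>j\<in>bounded_cells S M k. w' k j)
    = (\<Sum>k\<in>edges S. \<Sum>j\<in>bounded_cells S M k. w k j)"
proof -
  have cells_in: "bounded_cells S M k = {- int (M k)..<- int (M k) + int (M k)}"
    if "k \<in> in_edges S" for k
    using that by (auto simp: bounded_cells_def)
  have cells_out: "bounded_cells S M k = {0..<0 + int (M k)}" if "k \<in> out_edges S" for k
    using that by (auto simp: bounded_cells_def out_edges_not_in)
  define D where "D k = (\<Sum>j\<in>bounded_cells S M k. G k (j + 1) - G k j)" for k
  have "(\<Sum>k\<in>edges S. \<Sum>j\<in>bounded_cells S M k. w' k j)
      = (\<Sum>k\<in>edges S. (\<Sum>j\<in>bounded_cells S M k. w k j) - c * D k)"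
  proof (rule sum.cong[OF refl])
    fix k assume k: "k \<in> edges S"
    have "(\<Sum>j\<in>bounded_cells S M k. w' k j)
        = (\<Sum>j\<in>bounded_cells S M k. w k j - c * (G k (j + 1) - G k j))"
      using step[OF k] by (rule sum.cong[OF refl])
    also have "\<dots> = (\<Sum>j\<in>bounded_cells S M k. w k j) - c * D k"
      by (simp add: D_def sum_subtractf flip: sum_distrib_left)
    finally show "(\<Sum>j\<in>bounded_cells S M k. w' k j)
        = (\<Sum>j\<in>bounded_cells S M k. w k j) - c * D k" .
  qed
  also have "\<dots> = (\<Sum>k\<in>edges S. \<Sum>j\<in>bounded_cells S M k. w k j) - c * (\<Sum>k\<in>edges S. D k)"
    by (simp add: sum_subtractf sum_distrib_left)
  also have "(\<Sum>k\<in>edges S. D k) = 0"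
  proof -
    have "D k = G k 0" if k: "k \<in> in_edges S" for k
      using ends[of k] k unfolding D_def cells_in[OF k] sum_int_telescope
      by (simp add: end_face_def edges_def)
    moreover have "D k = - G k 0" if k: "k \<in> out_edges S" for k
      using ends[of k] k unfolding D_def cells_out[OF k] sum_int_telescope
      by (simp add: end_face_def edges_def out_edges_not_in)
    ultimately show ?thesis
      using node by (simp add: sum_edges_split sum_negf)
  qed
  finally show ?thesis by simp
qed

section \<open>Finite speed of propagation\<close>

definition supported_within ::
  "network_scheme \<Rightarrow> int \<Rightarrow> (nat \<Rightarrow> int \<Rightarrow> real) \<Rightarrow> bool" where
  "supported_within S L w \<longleftrightarrow> (\<forall>k\<in>edges S. \<forall>j\<in>cells S k. \<bar>j\<bar> > L \<longrightarrow> w k j = 0)"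

lemma compactly_supported_imp_supported_within:
  assumes "compactly_supported S w"
  shows "\<exists>L\<ge>0. supported_within S L w"
proof -
  let ?A = "{(k, j). k \<in> edges S \<and> j \<in> cells S k \<and> w k j \<noteq> 0}"
  have fin: "finite ((\<lambda>(k, j). \<bar>j\<bar>) ` ?A)"
    using assms by (auto simp: compactly_supported_def)
  let ?L = "Max (insert 0 ((\<lambda>(k, j). \<bar>j\<bar>) ` ?A))"
  have "\<bar>j\<bar> \<le> ?L" if "k \<in> edges S" "j \<in> cells S k" "w k j \<noteq> 0" for k j
    using that fin by (intro Max_ge) force+
  then have "supported_within S ?L w"
    unfolding supported_within_def by (meson not_le)
  moreover have "?L \<ge> 0" using fin by (intro Max_ge) auto
  ultimately show ?thesis by blast
qed

text \<open>
  The flux at the face \<open>j - 1/2\<close> uses the slopes in the cells \<open>j - 1\<close> and \<open>j\<close>, hence the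
  values in the cells \<open>j - 2, \<dots>, j + 1\<close>. A margin of two cells beyond the support keeps all
  of these at zero and keeps the stencil away from the ghost value at the node.
\<close>

lemma central_flux_zero_outside_support:
  assumes f0: "\<forall>k\<in>edges S. flux_fn S k 0 = 0" and supp: "supported_within S L w" and "L \<ge> 0"
    and k: "k \<in> edges S" and j: "j \<in> cells S k" and far: "\<bar>j\<bar> > L + 2"
  shows "central_flux S ord w k j = 0"
proof -
  have near: "i \<in> cells S k \<and> \<bar>i\<bar> > L" if "j - 2 \<le> i" "i \<le> j + 1" for i
    using that j far \<open>L \<ge> 0\<close> by (auto simp: cells_def split: if_splits)
  have w0: "w k i = 0" if "j - 2 \<le> i" "i \<le> j + 1" for i
    using near[OF that] supp k by (auto simp: supported_within_def)
  have W0: "split_state S w k s i = 0" if i: "j - 2 \<le> i" "i \<le> j + 1" for s i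
  proof -
    have "\<not> (k \<in> in_edges S \<and> i = 0 \<or> k \<in> out_edges S \<and> i = -1)"
      using near[OF i] by (auto simp: cells_def dest: out_edges_not_in split: if_splits)
    then show ?thesis using w0[OF i] f0 k by (auto simp: split_state_def)
  qed
  have "slope S w k s i = 0" if "i = j \<or> i = j - 1" for s i
    using that W0 by (auto simp: slope_def minmod_def Let_def)
  then have "extension_term S ord (slope S w) k j = 0"
    by (simp add: extension_term_def split: scheme_order.split)
  moreover have "real_of_int j * nu S k > 0"
    using j far \<open>L \<ge> 0\<close> by (auto simp: nu_def cells_def split: if_splits)
  ultimately show ?thesis
    using w0[of j] w0[of "j - 1"] f0 k by (simp add: central_flux_def num_flux_def)
qed

text \<open>
  One cell more than in the previous lemma, because the update of cell \<open>j\<close> also uses the flux at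
  the face \<open>j + 1/2\<close>.
\<close>

lemma supported_within_step:
  assumes u: "central_scheme S ord u" and f0: "\<forall>k\<in>edges S. flux_fn S k 0 = 0"
    and supp: "supported_within S L (u n)" and L: "L \<ge> 0"
  shows "supported_within S (L + 3) (u (Suc n))"
  unfolding supported_within_def
proof (intro ballI impI)
  fix k j assume k: "k \<in> edges S" and j: "j \<in> cells S k" and far: "\<bar>j\<bar> > L + 3"
  have "j + 1 \<in> cells S k" "\<bar>j + 1\<bar> > L + 2"
    using j far L by (auto simp: cells_def split: if_splits)
  then have "central_flux S ord (u n) k (j + 1) = 0" "central_flux S ord (u n) k j = 0"
    using central_flux_zero_outside_support[OF f0 supp L k] j far by auto
  moreover have "u n k j = 0" using supp k j far L by (auto simp: supported_within_def)
  ultimately show "u (Suc n) k j = 0"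
    using u k j by (simp add: central_scheme_def)
qed

lemma ex_supported_within:
  assumes u: "central_scheme S ord u" and f0: "\<forall>k\<in>edges S. flux_fn S k 0 = 0"
    and "compactly_supported S (u 0)"
  shows "\<exists>L\<ge>0. supported_within S L (u n)"
proof (induction n)
  case 0
  then show ?case using assms(3) compactly_supported_imp_supported_within by blast
next
  case (Suc n)
  then obtain L where "L \<ge> 0" "supported_within S L (u n)" by blast
  then show ?case
    using supported_within_step[OF u f0] by (intro exI[of _ "L + 3"]) auto
qed

section \<open>Conservation\<close>

lemma infsum_cells_eq_sum_bounded_cells:
  assumes supp: "supported_within S L w" and k: "k \<in> edges S" and M: "int (M k) > L"
  shows "w k summable_on cells S k"
    and "(\<Sum>\<^sub>\<infinity>j\<in>cells S k. w k j) = (\<Sum>j\<in>bounded_cells S M k. w k j)"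
proof -
  have fin: "finite (bounded_cells S M k)" by (simp add: bounded_cells_def)
  have sub: "bounded_cells S M k \<subseteq> cells S k" by (auto simp: bounded_cells_def cells_def)
  have out: "w k j = 0" if "j \<in> cells S k - bounded_cells S M k" for j
  proof -
    have "\<bar>j\<bar> > L" "j \<in> cells S k"
      using that M by (auto simp: bounded_cells_def cells_def split: if_splits)
    then show ?thesis using supp k by (auto simp: supported_within_def)
  qed
  have "w k summable_on cells S k \<longleftrightarrow> w k summable_on bounded_cells S M k"
    using sub out by (intro summable_on_cong_neutral) auto
  then show "w k summable_on cells S k" using fin by simp
  have "infsum (w k) (cells S k) = infsum (w k) (bounded_cells S M k)"
    using sub out by (intro infsum_cong_neutral) auto
  then show "(\<Sum>\<^sub>\<infinity>j\<in>cells S k. w k j) = (\<Sum>j\<in>bounded_cells S M k. w k j)"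
    using fin by simp
qed

lemma constant_if_step_invariant:
  assumes "\<And>n. f (Suc n) = f n"
  shows "f n = f (m::nat)"
proof -
  have "f n = f 0" for n using assms by (induction n) auto
  then show ?thesis by metis
qed

lemma conservative_in_node_central_scheme:
  assumes "scheme_data S"
  shows "conservative_in_node S ord u"
  unfolding conservative_in_node_def central_flux_def
  by (intro allI num_flux_balanced_at_node assms)

theorem conservative_full_central_scheme:
  assumes S: "scheme_data S" and f0: "\<forall>k\<in>edges S. flux_fn S k 0 = 0"
    and u: "central_scheme S ord u" and supp: "compactly_supported S (u 0)"
  shows "conservative_full S u"
proof -
  let ?mass = "\<lambda>n. \<Sum>k\<in>edges S. \<Sum>\<^sub>\<infinity>j\<in>cells S k. u n k j"
  have ex: "\<exists>L\<ge>0. supported_within S L (u n)" for n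
    using ex_supported_within[OF u f0 supp] .
  have summable: "u n k summable_on cells S k" if k: "k \<in> edges S" for n k
  proof -
    obtain L where "L \<ge> 0" "supported_within S L (u n)" using ex by blast
    then show ?thesis
      using infsum_cells_eq_sum_bounded_cells(1)[of S L "u n" k "\<lambda>_. nat (L + 1)"] k by simp
  qed
  have mass_step: "?mass (Suc n) = ?mass n" for n
  proof -
    obtain L where L: "L \<ge> 0" and supp_n: "supported_within S L (u n)" using ex by blast
    \<comment> \<open>A truncation that contains the supports of both time levels and has zero flux at its
      ends.\<close>
    define M where "M = (\<lambda>_::nat. nat (L + 4))"
    have supp_Suc: "supported_within S (L + 3) (u (Suc n))"
      using supported_within_step[OF u f0 supp_n L] .
    have M: "int (M k) = L + 4" for k using L by (simp add: M_def)
    have "?mass (Suc n) = (\<Sum>k\<in>edges S. \<Sum>j\<in>bounded_cells S M k. u (Suc n) k j)"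
      using infsum_cells_eq_sum_bounded_cells(2)[OF supp_Suc, of _ M]
      by (intro sum.cong) (auto simp: M)
    also have "\<dots> = (\<Sum>k\<in>edges S. \<Sum>j\<in>bounded_cells S M k. u n k j)"
    proof (rule mass_balance[where G = "central_flux S ord (u n)"])
      fix k j assume "k \<in> edges S" "j \<in> bounded_cells S M k"
      then show "u (Suc n) k j = u n k j - time_step S / cell_width S *
          (central_flux S ord (u n) k (j + 1) - central_flux S ord (u n) k j)"
        using u by (auto simp: central_scheme_def bounded_cells_def cells_def split: if_splits)
    next
      fix k assume k: "k \<in> edges S"
      have "end_face S M k \<in> cells S k" "\<bar>end_face S M k\<bar> > L + 2"
        using L by (auto simp: end_face_def cells_def M)
      then show "central_flux S ord (u n) k (end_face S M k) = 0"
        using central_flux_zero_outside_support[OF f0 supp_n L k] by blast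
    next
      show "(\<Sum>k\<in>in_edges S. central_flux S ord (u n) k 0)
          = (\<Sum>k\<in>out_edges S. central_flux S ord (u n) k 0)"
        unfolding central_flux_def by (rule num_flux_balanced_at_node[OF S])
    qed
    also have "\<dots> = ?mass n"
      using infsum_cells_eq_sum_bounded_cells(2)[OF supp_n, of _ M]
      by (intro sum.cong) (auto simp: M)
    finally show ?thesis .
  qed
  have "?mass n = ?mass m" for n m
    by (rule constant_if_step_invariant[of ?mass]) (rule mass_step)
  then show ?thesis
    unfolding conservative_full_def using summable by blast
qed

text \<open>
  Since every edge has at least one cell, the node is never one of the faces where the flux is
  replaced by zero. The node flux contains no extension term, so the slopes chosen in the end
  cells do not affect the balance there either.
\<close>

theorem conservative_bounded_scheme:
  assumes S: "scheme_data S" and M: "\<forall>k\<in>edges S. M k \<ge> 1" and u: "bounded_scheme S ord M e u"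
  shows "conservative_bounded S M u"
proof -
  let ?mass = "\<lambda>n. \<Sum>k\<in>edges S. \<Sum>j\<in>bounded_cells S M k. u n k j"
  have mass_step: "?mass (Suc n) = ?mass n" for n
  proof (rule mass_balance[where G = "bounded_flux S ord M (e n) (u n)"])
    fix k j assume "k \<in> edges S" "j \<in> bounded_cells S M k"
    then show "u (Suc n) k j = u n k j - time_step S / cell_width S *
        (bounded_flux S ord M (e n) (u n) k (j + 1) - bounded_flux S ord M (e n) (u n) k j)"
      using u by (simp add: bounded_scheme_def)
  next
    fix k
    show "bounded_flux S ord M (e n) (u n) k (end_face S M k) = 0"
      by (simp add: bounded_flux_def)
  next
    have "bounded_flux S ord M (e n) (u n) k 0
        = num_flux S ord (bounded_slope S M (e n) (u n)) (u n) k 0" if "k \<in> edges S" for k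
      using that M by (force simp: bounded_flux_def end_face_def)
    then show "(\<Sum>k\<in>in_edges S. bounded_flux S ord M (e n) (u n) k 0)
        = (\<Sum>k\<in>out_edges S. bounded_flux S ord M (e n) (u n) k 0)"
      using num_flux_balanced_at_node[OF S, of ord "bounded_slope S M (e n) (u n)" "u n"]
      by (simp add: edges_def)
  qed
  have "?mass n = ?mass m" for n m
    by (rule constant_if_step_invariant[of ?mass]) (rule mass_step)
  then show ?thesis unfolding conservative_bounded_def by blast
qed

theorem proposition5:
  fixes S :: network_scheme and ord :: scheme_order
  assumes "scheme_data S"
  shows
    "(\<forall>u. central_scheme S ord u \<longrightarrow> conservative_in_node S ord u) \<and>
     ((\<forall>k\<in>edges S. flux_fn S k 0 = 0) \<longrightarrow>
        (\<forall>u. central_scheme S ord u \<and> compactly_supported S (u 0) \<longrightarrow> conservative_full S u)) \<and>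
     (\<forall>M e u. (\<forall>k\<in>edges S. M k \<ge> 1) \<and> bounded_scheme S ord M e u \<longrightarrow> conservative_bounded S M u)"
  using conservative_in_node_central_scheme[OF assms] conservative_full_central_scheme[OF assms]
    conservative_bounded_scheme[OF assms]
  by blast

end
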